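(* As an identity of meromorphic functions of $\lambda\in\mathfrak{h}^*$, $$\sum_{p=\pm\varepsilon_1,\ q=\pm\varepsilon_2}U(\lambda_p,\lambda_q)-\sum_{p=\pm\varepsilon_1,\ q=\pm\varepsilon_2}\frac{\theta_1(\lambda_{p+q}-\hbar)\,\theta_1(\lambda_{p+q}+2\hbar)}{\theta_1(\lambda_{p+q})\,\theta_1(\lambda_{p+q}+\hbar)}=K,$$ where $$U(\lambda_p,\lambda_q)=\frac{\theta_1(2\hbar)}{\theta_1(6\hbar)}\,\frac{\theta_1(2\lambda_p+2\hbar)\,\theta_1(2\lambda_q+2\hbar)}{\theta_1(2\lambda_p)\,\theta_1(2\lambda_q)}\,\frac{\theta_1(\lambda_{p+q}-5\hbar)\,\theta_1(\lambda_{p+q}+2\hbar)}{\theta_1(\lambda_{p+q})\,\theta_1(\lambda_{p+q}+\hbar)}$$ and $K$ is the constant (independent of $\lambda$) $$K=-\left(\frac{\theta_1(8\hbar)\theta_1(\hbar)}{\theta_1(6\hbar)\theta_1(5\hbar)}+\frac{\theta_1(5\hbar)\theta_1(2\hbar)}{\theta_1(4\hbar)\theta_1(3\hbar)}+\frac{\theta_1(6\hbar)\theta_1(3\hbar)}{\theta_1(5\hbar)\theta_1(4\hbar)}+\frac{\theta_1(4\hbar)\theta_1(\hbar)}{\theta_1(3\hbar)\theta_1(2\hbar)}\right).$$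
   Context: For fixed $\tau$ in the upper half plane, $\theta_1(z)=\theta_1(z|\tau)=\sum_{k\in\mathbb{Z}}\exp\left[2\pi i\left((z+\tfrac12)(k+\tfrac12)+\tfrac12(k+\tfrac12)^2\tau\right)\right]$. Let $\mathfrak{h}^*=\mathbb{C}\varepsilon_1\oplus\mathbb{C}\varepsilon_2$ with the symmetric bilinear form $(\varepsilon_j,\varepsilon_k)=\frac12\delta_{jk}$; for $\lambda,p\in\mathfrak{h}^*$ write $\lambda_p:=(\lambda,p)$, so $\lambda_{p+q}=\lambda_p+\lambda_q$. The parameter $\hbar\in\mathbb{C}$ is fixed and generic (so that the constant denominators $\theta_1(k\hbar)$, $2\le k\le6$, do not vanish). *)

theory Defs
  imports "HOL-Analysis.Analysis"
begin

definition theta1 :: "complex \<Rightarrow> complex \<Rightarrow> complex" where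
  "theta1 \<tau> z = (\<Sum>\<^sub>\<infinity>k::int. exp (2 * of_real pi * \<i> *
     ((z + 1/2) * (of_int k + 1/2) + 1/2 * (of_int k + 1/2)^2 * \<tau>)))"

(* The complex-bilinear form on h^* = C \<epsilon>1 + C \<epsilon>2 with (\<epsilon>j, \<epsilon>k) = \<delta>jk / 2.
   The library's inner product on complex^2 is real-valued and hence not usable here. *)
definition hform :: "complex^2 \<Rightarrow> complex^2 \<Rightarrow> complex" where
  "hform x y = 1/2 * (\<Sum>j\<in>UNIV. x $ j * y $ j)"

definition \<epsilon>1 :: "complex^2" where "\<epsilon>1 = axis 1 1"

definition \<epsilon>2 :: "complex^2" where "\<epsilon>2 = axis 2 1"

(* U(x, y) with x = \<lambda>_p and y = \<lambda>_q, so that \<lambda>_(p+q) = x + y. *)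
definition U :: "complex \<Rightarrow> complex \<Rightarrow> complex \<Rightarrow> complex \<Rightarrow> complex" where
  "U \<tau> h x y =
     theta1 \<tau> (2*h) / theta1 \<tau> (6*h)
     * ((theta1 \<tau> (2*x + 2*h) * theta1 \<tau> (2*y + 2*h)) / (theta1 \<tau> (2*x) * theta1 \<tau> (2*y)))
     * ((theta1 \<tau> (x + y - 5*h) * theta1 \<tau> (x + y + 2*h))
        / (theta1 \<tau> (x + y) * theta1 \<tau> (x + y + h)))"

definition K :: "complex \<Rightarrow> complex \<Rightarrow> complex" where
  "K \<tau> h = - (
       (theta1 \<tau> (8*h) * theta1 \<tau> h) / (theta1 \<tau> (6*h) * theta1 \<tau> (5*h))
     + (theta1 \<tau> (5*h) * theta1 \<tau> (2*h)) / (theta1 \<tau> (4*h) * theta1 \<tau> (3*h))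
     + (theta1 \<tau> (6*h) * theta1 \<tau> (3*h)) / (theta1 \<tau> (5*h) * theta1 \<tau> (4*h))
     + (theta1 \<tau> (4*h) * theta1 \<tau> h) / (theta1 \<tau> (3*h) * theta1 \<tau> (2*h)))"

(* Points \<lambda> at which no denominator depending on \<lambda> vanishes. The two sides of the identity
   are meromorphic in \<lambda>, so their equality as meromorphic functions means equality at
   all these points. *)
definition regular_point :: "complex \<Rightarrow> complex \<Rightarrow> complex^2 \<Rightarrow> bool" where
  "regular_point \<tau> h l \<longleftrightarrow> (\<forall>p\<in>{\<epsilon>1, -\<epsilon>1}. \<forall>q\<in>{\<epsilon>2, -\<epsilon>2}.
     theta1 \<tau> (2 * hform l p) \<noteq> 0 \<and> theta1 \<tau> (2 * hform l q) \<noteq> 0 \<and>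
     theta1 \<tau> (hform l (p + q)) \<noteq> 0 \<and> theta1 \<tau> (hform l (p + q) + h) \<noteq> 0)"

end

theory Submission
  imports Defs
begin

text \<open>
  Put \<open>u = \<lambda>\<^bsub>\<epsilon>1\<^esub> + \<lambda>\<^bsub>\<epsilon>2\<^esub>\<close> and \<open>v = \<lambda>\<^bsub>\<epsilon>2\<^esub> - \<lambda>\<^bsub>\<epsilon>1\<^esub>\<close>, so that the doubled arguments
  become \<open>u - v\<close> and \<open>u + v\<close> and every theta factor is linear in \<open>u, v\<close> with coefficients
  in \<open>{-1, 0, 1}\<close>. In these variables the identity follows algebraically from Weierstrass's three-term
  relation.

  The three-term relation holds because \<open>\<theta>\<^sub>1(x + z) \<theta>\<^sub>1(x - z)\<close> is a \<open>2 \<times> 2\<close> determinant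
  \<open>A(x) B(z) - B(x) A(z)\<close> (lemma \<open>theta1_product\<close>): in the double series substitute
  \<open>p = k + l + 1\<close>, \<open>q = k - l\<close>. These run over the pairs of integers of opposite parity, and the
  two possible distributions of the parities give the two terms of the determinant. The three-term
  relation is then the Pluecker relation between \<open>2 \<times> 2\<close> minors.

  Write \<open>\<theta>\<^sub>k\<close> for \<open>\<theta>\<^sub>1(k\<hbar>)\<close> within this paragraph and \<open>F\<close> for \<open>ratio\<close>. Pairing the terms of the
  first sum which contain the same factor depending on \<open>u + v\<close>, the poles along \<open>u = v\<close> cancel and
  the dependence on \<open>u\<close> and \<open>v\<close> factorises (lemma \<open>weight_antisymmetric_sum\<close>): what is left is a
  combination of \<open>F(u) F(v)\<close> and \<open>F(u + \<hbar>) F(v + \<hbar>)\<close>, where \<open>F\<close> has shift \<open>-2\<hbar>\<close>.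
  Adding the two pairs cancels the poles along \<open>u = -v\<close>. The part with
  \<open>F(u) F(v)\<close> becomes a constant (lemma \<open>ratio_symmetrization\<close>); the part with
  \<open>F(u + \<hbar>) F(v + \<hbar>)\<close> is \<open>- cross_term\<close>, a function with poles at \<open>u = \<plusminus>\<hbar>\<close> and \<open>v = \<plusminus>\<hbar>\<close> which
  are exactly those of the subtracted sum. That the total is constant is lemma
  \<open>invariant_constant\<close>; its value is read off at \<open>u = 4\<hbar>\<close>, \<open>v = 2\<hbar>\<close>. There a
  contribution \<open>\<theta>\<^sub>4 \<theta>\<^sub>5 / (\<theta>\<^sub>6 \<theta>\<^sub>1)\<close> cancels against the first constant, and the four
  summands of \<open>K\<close> remain.
\<close>

section \<open>Products of theta series\<close>

lemma infsum_product:
  fixes f g :: "_ \<Rightarrow> complex"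
  assumes "(\<lambda>x. norm (f x)) summable_on X" and "(\<lambda>y. norm (g y)) summable_on Y"
  shows "(\<lambda>(x, y). f x * g y) summable_on X \<times> Y"
    and "infsum (\<lambda>(x, y). f x * g y) (X \<times> Y) = infsum f X * infsum g Y"
proof -
  have "(\<lambda>p. norm ((\<lambda>(x, y). f x * g y) p)) summable_on X \<times> Y"
    by (subst Infinite_Sum.abs_summable_on_Sigma_iff)
       (auto simp: norm_mult infsum_cmult_right' abs_mult
             intro!: summable_on_cmult_right summable_on_cmult_left assms)
  then show s: "(\<lambda>(x, y). f x * g y) summable_on X \<times> Y"
    by (rule abs_summable_summable)
  show "infsum (\<lambda>(x, y). f x * g y) (X \<times> Y) = infsum f X * infsum g Y"
    using infsum_Sigma'_banach[OF s] by (simp add: infsum_cmult_right' infsum_cmult_left')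
qed

text \<open>
  A geometric majorant for the Gaussian series over the integers below.
\<close>

lemma exp_minus_abs_summable: "(\<lambda>n::int. exp (- \<bar>real_of_int n\<bar>)) summable_on UNIV"
proof -
  have geom: "(\<lambda>n::nat. exp (- real n)) summable_on UNIV"
  proof (rule norm_summable_imp_summable_on)
    have "summable (\<lambda>n::nat. exp (- 1 :: real) ^ n)"
      by (rule summable_geometric) simp
    then show "summable (\<lambda>n::nat. norm (exp (- real n)))"
      by (simp add: exp_of_nat_mult[symmetric])
  qed
  have "(\<lambda>n::int. exp (- \<bar>real_of_int n\<bar>)) summable_on range int"
    by (subst summable_on_reindex) (use geom in \<open>auto simp: o_def\<close>)
  moreover have "(\<lambda>n::int. exp (- \<bar>real_of_int n\<bar>)) summable_on range (\<lambda>n. - int n)"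
    by (subst summable_on_reindex) (use geom in \<open>auto simp: o_def inj_on_def\<close>)
  ultimately have "(\<lambda>n::int. exp (- \<bar>real_of_int n\<bar>)) summable_on range int \<union> range (\<lambda>n. - int n)"
    by (rule summable_on_union)
  also have "range int \<union> range (\<lambda>n. - int n) = UNIV"
    by (auto simp: image_iff) (metis int_cases2)
  finally show ?thesis .
qed

text \<open>
  The general term of a theta series in \<open>x\<close> with modulus \<open>\<tau>/2\<close>. This scaling is the one produced by
  \<open>k\<^sup>2 + l\<^sup>2 = ((k + l)\<^sup>2 + (k - l)\<^sup>2) / 2\<close>.
\<close>

definition gauss_term :: "complex \<Rightarrow> complex \<Rightarrow> int \<Rightarrow> complex" where
  "gauss_term \<tau> x p = exp (2 * of_real pi * \<i> * (x * of_int p + (of_int p)^2 * \<tau> / 4))"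

lemma gauss_term_abs_summable:
  assumes "Im \<tau> > 0"
  shows "(\<lambda>p. norm (gauss_term \<tau> x p)) summable_on X"
proof -
  define b where "b = - 2 * pi * Im x"
  define c where "c = pi * Im \<tau> / 2"
  have c: "c > 0" using assms by (simp add: c_def)
  define C where "C = (\<bar>b\<bar> + 1)\<^sup>2 / (4 * c)"
  have nrm: "norm (gauss_term \<tau> x p) = exp (b * of_int p - c * (of_int p)\<^sup>2)" for p
    by (simp add: gauss_term_def norm_exp_eq_Re b_def c_def algebra_simps power2_eq_square)
  \<comment> \<open>Completing the square: the Gaussian decay absorbs both the linear term and an extra \<open>-\<bar>p\<bar>\<close>,
     at the cost of the constant \<open>C\<close>.\<close>
  have bound: "norm (gauss_term \<tau> x p) \<le> exp C * exp (- \<bar>of_int p\<bar>)" for p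
  proof -
    define t :: real where "t = \<bar>of_int p\<bar>"
    have "0 \<le> (2 * c * t - (\<bar>b\<bar> + 1))\<^sup>2 / (4 * c)" using c by simp
    also have "\<dots> = c * t\<^sup>2 - (\<bar>b\<bar> + 1) * t + C"
      using c by (simp add: C_def power2_eq_square field_simps)
    finally have "\<bar>b\<bar> * t - c * t\<^sup>2 \<le> C - t" by (simp add: algebra_simps)
    moreover have "b * of_int p \<le> \<bar>b\<bar> * t"
      unfolding t_def by (metis abs_ge_self abs_mult)
    moreover have "t\<^sup>2 = (of_int p)\<^sup>2" by (simp add: t_def)
    ultimately show ?thesis
      unfolding nrm exp_add[symmetric] t_def[symmetric] by (simp add: t_def)
  qed
  have "(\<lambda>p. exp C * exp (- \<bar>real_of_int p\<bar>)) summable_on X"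
    by (rule summable_on_subset_banach[OF summable_on_cmult_right[OF exp_minus_abs_summable]]) simp
  then show ?thesis
    by (rule Infinite_Sum.abs_summable_on_comparison_test') (use bound in auto)
qed

text \<open>
  Up to the rescaling of the variable these are Jacobi's \<open>\<theta>\<^sub>3\<close> and \<open>\<theta>\<^sub>2\<close> with modulus \<open>2\<tau>\<close>.
\<close>

definition even_theta :: "complex \<Rightarrow> complex \<Rightarrow> complex" where
  "even_theta \<tau> x = infsum (gauss_term \<tau> x) {p. even p}"

definition odd_theta :: "complex \<Rightarrow> complex \<Rightarrow> complex" where
  "odd_theta \<tau> x = infsum (gauss_term \<tau> x) {p. odd p}"

text \<open>
  With \<open>n = k + 1/2\<close>, \<open>m = l + 1/2\<close> the exponents depend on \<open>n + m\<close> and \<open>n - m\<close> separately. The shift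
  of the argument by \<open>1/2\<close> leaves the sign \<open>exp(\<pi>\<i>(n + m))\<close>.
\<close>

lemma theta1_terms_product:
  fixes k l :: int
  shows "exp (2 * of_real pi * \<i> * ((x + z + 1/2) * (of_int k + 1/2) + 1/2 * (of_int k + 1/2)^2 * \<tau>))
       * exp (2 * of_real pi * \<i> * ((x - z + 1/2) * (of_int l + 1/2) + 1/2 * (of_int l + 1/2)^2 * \<tau>))
       = (if even (k + l + 1) then 1 else -1) * (gauss_term \<tau> x (k + l + 1) * gauss_term \<tau> z (k - l))"
    (is "?L = _")
proof -
  have sgn: "exp (of_real pi * \<i> * of_int (k + l + 1)) = (if even (k + l + 1) then 1 else -1)"
  proof (cases "even (k + l + 1)")
    case True
    then obtain m where "k + l + 1 = 2 * m" by (elim evenE)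
    then have "exp (of_real pi * \<i> * of_int (k + l + 1)) = exp (2 * of_int m * of_real pi * \<i>)"
      by (simp add: mult_ac)
    also have "\<dots> = 1" by (simp add: exp_eq_1)
    finally show ?thesis using True by simp
  next
    case False
    then obtain m where m: "k + l + 1 = 2 * m + 1" by (elim oddE)
    have "exp (of_real pi * \<i> * of_int (k + l + 1)) = exp (2 * of_int m * of_real pi * \<i> + of_real pi * \<i>)"
      unfolding m by (simp add: algebra_simps)
    also have "\<dots> = exp (2 * of_int m * of_real pi * \<i>) * exp (of_real pi * \<i>)" by (rule exp_add)
    also have "exp (2 * of_int m * of_real pi * \<i>) = 1" by (simp add: exp_eq_1)
    finally show ?thesis using False by simp
  qed
  have "?L = exp (of_real pi * \<i> * of_int (k + l + 1)) * (gauss_term \<tau> x (k + l + 1) * gauss_term \<tau> z (k - l))"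
    unfolding gauss_term_def exp_add[symmetric]
    by (rule arg_cong[where f = exp]) (simp add: field_simps power2_eq_square)
  then show ?thesis unfolding sgn .
qed

text \<open>
  The integers \<open>k + l + 1\<close> and \<open>k - l\<close> have opposite parity, and every such pair arises exactly once.
  The double series therefore splits into an (even, odd) and an (odd, even) part, each a
  product of two single series; the sign is that of the parity of the first index.
\<close>

lemma theta1_product:
  assumes "Im \<tau> > 0"
  shows "theta1 \<tau> (x + z) * theta1 \<tau> (x - z)
       = even_theta \<tau> x * odd_theta \<tau> z - odd_theta \<tau> x * even_theta \<tau> z"
proof -
  define e where "e z k = exp (2 * of_real pi * \<i> *
     ((z + 1/2) * (of_int k + 1/2) + 1/2 * (of_int k + 1/2)^2 * \<tau>))" for z and k :: int
  have theta: "theta1 \<tau> z = infsum (e z) UNIV" for z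
    by (simp add: theta1_def e_def[abs_def])
  \<comment> \<open>The terms of \<open>\<theta>\<^sub>1\<close> are themselves Gaussian, which gives their absolute summability.\<close>
  have e_gauss: "e z k = exp (2 * of_real pi * \<i> * (z/2 + 1/4 + \<tau>/8)) * gauss_term (2 * \<tau>) (z + 1/2 + \<tau>/2) k" for z k
    unfolding e_def gauss_term_def exp_add[symmetric]
    by (rule arg_cong[where f = exp]) (simp add: field_simps power2_eq_square)
  have e_abs: "(\<lambda>k. norm (e z k)) summable_on UNIV" for z
    unfolding e_gauss norm_mult
    by (intro summable_on_cmult_right gauss_term_abs_summable) (use assms in simp)
  define s where "s p = (if even p then 1 else -1 :: complex)" for p :: int
  define G where "G = (\<lambda>(p, q). s p * (gauss_term \<tau> x p * gauss_term \<tau> z q))"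
  define EO where "EO = {p::int. even p} \<times> {q::int. odd q}"
  define OE where "OE = {p::int. odd p} \<times> {q::int. even q}"
  note g = gauss_term_abs_summable[OF assms]
  have "theta1 \<tau> (x + z) * theta1 \<tau> (x - z)
      = infsum (\<lambda>(k, l). e (x + z) k * e (x - z) l) (UNIV \<times> UNIV)"
    unfolding theta by (rule infsum_product(2)[OF e_abs e_abs, symmetric])
  also have "\<dots> = infsum G (EO \<union> OE)"
  proof (rule infsum_reindex_bij_witness[where i = "\<lambda>(p, q). ((p + q - 1) div 2, (p - q - 1) div 2)"
                                          and j = "\<lambda>(k, l). (k + l + 1, k - l)"])
    show "G ((\<lambda>(k, l). (k + l + 1, k - l)) a) = (\<lambda>(k, l). e (x + z) k * e (x - z) l) a" for a
      unfolding G_def s_def e_def by (cases a) (simp only: theta1_terms_product prod.case)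
  next
    fix b assume "b \<in> EO \<union> OE"
    then have odd: "odd (fst b + snd b)" by (auto simp: EO_def OE_def)
    then have "2 * ((fst b + snd b - 1) div 2) = fst b + snd b - 1"
      and "2 * ((fst b - snd b - 1) div 2) = fst b - snd b - 1" by auto
    then show "(\<lambda>(k, l). (k + l + 1, k - l)) ((\<lambda>(p, q). ((p + q - 1) div 2, (p - q - 1) div 2)) b) = b"
      by (auto simp: case_prod_beta prod_eq_iff)
  qed (auto simp: EO_def OE_def)
  also have "\<dots> = infsum G EO + infsum G OE"
  proof (rule infsum_Un_disjoint)
    have "(\<lambda>(p, q). gauss_term \<tau> x p * gauss_term \<tau> z q) summable_on EO"
      unfolding EO_def by (rule infsum_product(1)[OF g g])
    then show "G summable_on EO"
      by (rule summable_on_cong[THEN iffD1, rotated]) (auto simp: G_def s_def EO_def)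
    have "(\<lambda>(p, q). gauss_term \<tau> x p * gauss_term \<tau> z q) summable_on OE"
      unfolding OE_def by (rule infsum_product(1)[OF g g])
    then have "(\<lambda>a. - ((\<lambda>(p, q). gauss_term \<tau> x p * gauss_term \<tau> z q) a)) summable_on OE"
      by (rule summable_on_uminus[THEN iffD2])
    then show "G summable_on OE"
      by (rule summable_on_cong[THEN iffD1, rotated]) (auto simp: G_def s_def OE_def)
  qed (auto simp: EO_def OE_def)
  also have "infsum G EO = infsum (\<lambda>(p, q). gauss_term \<tau> x p * gauss_term \<tau> z q) EO"
    by (rule infsum_cong) (auto simp: G_def s_def EO_def)
  also have "\<dots> = even_theta \<tau> x * odd_theta \<tau> z"
    unfolding EO_def even_theta_def odd_theta_def by (rule infsum_product(2)[OF g g])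
  also have "infsum G OE = infsum (\<lambda>a. - ((\<lambda>(p, q). gauss_term \<tau> x p * gauss_term \<tau> z q) a)) OE"
    by (rule infsum_cong) (auto simp: G_def s_def OE_def)
  also have "\<dots> = - (odd_theta \<tau> x * even_theta \<tau> z)"
    unfolding infsum_uminus OE_def even_theta_def odd_theta_def infsum_product(2)[OF g g] by simp
  finally show ?thesis by simp
qed

section \<open>Theta relations from a determinant\<close>

text \<open>
  The determinant formula is the only property of \<open>\<theta>\<^sub>1\<close> on which the identity depends, so everything
  below is stated for an arbitrary function possessing one.
\<close>

locale determinantal_theta =
  fixes \<theta> A B :: "complex \<Rightarrow> complex"
  assumes product_eq_det: "\<theta> (x + z) * \<theta> (x - z) = A x * B z - B x * A z"
begin

text \<open>
  Exchanging \<open>x\<close> and \<open>z\<close> changes the sign of the determinant and replaces \<open>\<theta>(x - z)\<close> by \<open>\<theta>(z - x)\<close>,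
  while \<open>\<theta>(x + z)\<close> stays the same; so it suffices to choose \<open>x + z\<close> with \<open>\<theta>(x + z) \<noteq> 0\<close>.
\<close>

lemma theta_minus: "\<theta> (- d) = - \<theta> d"
proof (cases "\<forall>s. \<theta> s = 0")
  case True
  then show ?thesis by simp
next
  case False
  then obtain s where s: "\<theta> s \<noteq> 0" by blast
  define x z where "x = (s + d) / 2" and "z = (s - d) / 2"
  have "x + z = s" "x - z = d" "z + x = s" "z - x = - d"
    by (simp_all add: x_def z_def field_simps)
  then have "\<theta> s * \<theta> (- d) = - (\<theta> s * \<theta> d)"
    using product_eq_det[of x z] product_eq_det[of z x] by simp
  then show ?thesis using s by (metis minus_mult_right mult_left_cancel)
qed

lemma theta_0: "\<theta> 0 = 0"
  using theta_minus[of 0] by simp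

lemma theta_diff_commute: "\<theta> (a - b) = - \<theta> (b - a)"
  using theta_minus[of "b - a"] by simp

text \<open>
  Weierstrass's relation: the Pluecker relation for the four vectors \<open>(A, B)\<close> at \<open>x, y, z, w\<close>.
\<close>

lemma three_term:
  "\<theta> (x + y) * \<theta> (x - y) * (\<theta> (z + w) * \<theta> (z - w))
   = \<theta> (x + z) * \<theta> (x - z) * (\<theta> (y + w) * \<theta> (y - w))
   - \<theta> (x + w) * \<theta> (x - w) * (\<theta> (y + z) * \<theta> (y - z))"
  unfolding product_eq_det by algebra

text \<open>
  If \<open>a + b = c + d\<close>, then \<open>\<theta>(u + a) \<theta>(u + b) / (\<theta>(u + c) \<theta>(u + d))\<close> is a Moebius transform of
  \<open>A/B\<close> at the point \<open>u + (a + b)/2\<close>, and its values at two points differ by a single product. This is the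
  three-term relation with denominators cleared, and the form in which it is used most.
\<close>

lemma moebius_difference:
  assumes "a + b = c + d"
  shows "\<theta> (u + a) * \<theta> (u + b) * \<theta> (w + c) * \<theta> (w + d) - \<theta> (w + a) * \<theta> (w + b) * \<theta> (u + c) * \<theta> (u + d)
    = \<theta> (c - a) * \<theta> (d - a) * \<theta> (u - w) * \<theta> (u + w + a + b)"
proof -
  define s p q where "s = (a + b) / 2" and "p = (a - b) / 2" and "q = (c - d) / 2"
  have "c = (a + b) / 2 + q" "d = (a + b) / 2 - q"
    using assms by (auto simp: q_def field_simps)
  then have abcd: "a = s + p" "b = s - p" "c = s + q" "d = s - q"
    by (auto simp: s_def p_def field_simps)
  have "\<theta> (- p - q) = - \<theta> (p + q)" using theta_minus[of "p + q"] by simp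
  then show ?thesis
    using three_term[of "u + s" p "w + s" q] theta_diff_commute[of q p] theta_diff_commute[of p "s + w"]
    unfolding abcd by (simp add: algebra_simps)
qed

text \<open>
  The left-hand side vanishes for \<open>u = -v\<close>, \<open>u = -w\<close> and \<open>v = -w\<close>, which accounts for the factors
  on the right. It is the identity by which poles on these three loci cancel.
\<close>

lemma four_point:
  "\<theta> (v - h) * \<theta> (u - h) * \<theta> (w - h) * \<theta> (u + v + w + h)
   - \<theta> (v + h) * \<theta> (u + h) * \<theta> (w + h) * \<theta> (u + v + w - h)
   = - (\<theta> (2*h) * \<theta> (u + v) * \<theta> (u + w) * \<theta> (v + w))"
proof -
  have "\<theta> (- w - h) = - \<theta> (w + h)" "\<theta> (- v - w) = - \<theta> (v + w)" "\<theta> (h - w) = - \<theta> (w - h)"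
    using theta_minus[of "w + h"] theta_minus[of "v + w"] theta_minus[of "w - h"] by simp_all
  then show ?thesis
    using moebius_difference[of "v + h" "- w - h" "v - h" "h - w" "u + w" 0]
    by (simp add: theta_minus algebra_simps)
qed

lemma three_point:
  "\<theta> a * (\<theta> (u + v + a) * \<theta> (u - a) * \<theta> (v - a) + \<theta> (u + v - a) * \<theta> (u + a) * \<theta> (v + a))
   = \<theta> (2*a) * \<theta> (u + v) * \<theta> u * \<theta> v"
  using four_point[of 0 a u v] by (simp add: theta_minus algebra_simps)

definition ratio :: "complex \<Rightarrow> complex \<Rightarrow> complex" where
  "ratio a z = \<theta> (z + a) / \<theta> z"

lemma ratio_minus: "ratio a (- z) = ratio (- a) z"
  using theta_minus[of "z - a"] by (simp add: ratio_def theta_minus)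

text \<open>
  The pole along \<open>u + v = 0\<close> cancels between the two terms, and so do those at \<open>u = 0\<close> and
  \<open>v = 0\<close>; algebraically this is \<open>three_point\<close> divided by \<open>\<theta>(u + v) \<theta>(u) \<theta>(v)\<close>.
\<close>

lemma ratio_symmetrization:
  assumes "\<theta> a \<noteq> 0" "\<theta> u \<noteq> 0" "\<theta> v \<noteq> 0" "\<theta> (u + v) \<noteq> 0"
  shows "ratio a (u + v) * ratio (- a) u * ratio (- a) v + ratio (- a) (u + v) * ratio a u * ratio a v
       = \<theta> (2 * a) / \<theta> a"
proof -
  have "(\<theta> (u + v + a) * \<theta> (u - a) * \<theta> (v - a) + \<theta> (u + v - a) * \<theta> (u + a) * \<theta> (v + a))
      = \<theta> (2*a) / \<theta> a * \<theta> (u + v) * \<theta> u * \<theta> v"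
    using three_point[of a u v] assms by (simp add: field_simps)
  then have "(\<theta> (u + v + a) * \<theta> (u - a) * \<theta> (v - a) + \<theta> (u + v - a) * \<theta> (u + a) * \<theta> (v + a))
     / (\<theta> (u + v) * \<theta> u * \<theta> v) = \<theta> (2*a) / \<theta> a"
    using assms by (simp add: field_simps)
  then show ?thesis
    by (simp add: ratio_def add_divide_distrib)
qed

text \<open>
  Cancelling the pole along \<open>u = v\<close> separates the variables. This is again \<open>three_point\<close>, at the
  arguments \<open>u - a\<close> and \<open>a - v\<close>.
\<close>

lemma ratio_antisymmetric_sum:
  assumes "\<theta> a \<noteq> 0" "\<theta> u \<noteq> 0" "\<theta> v \<noteq> 0" "\<theta> (u - v) \<noteq> 0"
  shows "ratio a (u - v) * ratio (- (2 * a)) u + ratio a (v - u) * ratio (- (2 * a)) v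
       = \<theta> (2 * a) / \<theta> a * (ratio (- a) u * ratio (- a) v)"
proof -
  have "\<theta> (u - v + a) * \<theta> (u - 2*a) * \<theta> v + \<theta> (u - v - a) * \<theta> (v - 2*a) * \<theta> u
      = \<theta> (2*a) / \<theta> a * \<theta> (u - v) * \<theta> (u - a) * \<theta> (v - a)"
    using three_point[of a "u - a" "a - v"] assms(1)
      theta_diff_commute[of a v] theta_diff_commute[of "2*a" v] theta_minus[of v]
    by (simp add: field_simps)
  then have "(\<theta> (u - v + a) * \<theta> (u - 2*a) * \<theta> v + \<theta> (u - v - a) * \<theta> (v - 2*a) * \<theta> u)
        / (\<theta> (u - v) * \<theta> u * \<theta> v)
      = \<theta> (2*a) / \<theta> a * (\<theta> (u - a) / \<theta> u * (\<theta> (v - a) / \<theta> v))"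
    using assms by simp
  moreover have "ratio a (v - u) = \<theta> (u - v - a) / \<theta> (u - v)"
    using ratio_minus[of a "u - v"] by (simp add: ratio_def)
  ultimately show ?thesis
    using assms by (simp add: ratio_def add_divide_distrib)
qed

text \<open>
  The three-term relation among multiples of \<open>h\<close> reads
  \<open>\<theta>(5h) \<theta>(h)\<^sup>3 = \<theta>(4h) \<theta>(2h)\<^sup>3 - \<theta>(3h)\<^sup>3 \<theta>(h)\<close>.
\<close>

lemma theta_step_nonzero:
  assumes "\<theta> (2*h) \<noteq> 0" "\<theta> (4*h) \<noteq> 0"
  shows "\<theta> h \<noteq> 0"
proof
  assume "\<theta> h = 0"
  then have "\<theta> (4*h) * \<theta> (2*h) ^ 3 = 0"
    using three_term[of "3*h" "2*h" h 0] by (simp add: power3_eq_cube mult_ac)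
  then show False using assms by simp
qed

section \<open>Eliminating the poles along \<open>u = v\<close>\<close>

definition weight :: "complex \<Rightarrow> complex \<Rightarrow> complex" where
  "weight h s = \<theta> (s - 5*h) * \<theta> (s + 2*h) / (\<theta> s * \<theta> (s + h))"

definition subtracted :: "complex \<Rightarrow> complex \<Rightarrow> complex" where
  "subtracted h s = \<theta> (s - h) * \<theta> (s + 2*h) / (\<theta> s * \<theta> (s + h))"

text \<open>
  Both partial fractions are ratios with shift \<open>-4h\<close>, which is twice the shift \<open>2h\<close> of the prefactors
  \<open>ratio (2h)\<close>, with opposite sign: the situation of \<open>ratio_antisymmetric_sum\<close>.
\<close>

lemma weight_partial_fractions:
  assumes "\<theta> h \<noteq> 0" "\<theta> (4*h) \<noteq> 0" "\<theta> s \<noteq> 0" "\<theta> (s + h) \<noteq> 0"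
  shows "weight h s = \<theta> (5*h) * \<theta> (2*h) / (\<theta> (4*h) * \<theta> h) * ratio (- (4*h)) s
               - \<theta> (6*h) / \<theta> (4*h) * ratio (- (4*h)) (s + h)"
proof -
  have "\<theta> (s - 5*h) * \<theta> (s + 2*h) * (\<theta> (4*h) * \<theta> h)
      = \<theta> (5*h) * \<theta> (2*h) * \<theta> (s - 4*h) * \<theta> (s + h) - \<theta> (6*h) * \<theta> h * \<theta> (s - 3*h) * \<theta> s"
    using moebius_difference[of "-5*h" "2*h" "-4*h" h s 0]
    by (simp add: theta_minus algebra_simps)
  then show ?thesis
    using assms by (simp add: weight_def ratio_def divide_simps) (simp add: algebra_simps)
qed

text \<open>
  Each partial fraction is treated by \<open>ratio_antisymmetric_sum\<close>; the second one is evaluated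
  at \<open>u + h\<close>, \<open>v + h\<close>, which leaves \<open>u - v\<close> unchanged.
\<close>

lemma weight_antisymmetric_sum:
  assumes h: "\<theta> h \<noteq> 0" "\<theta> (2*h) \<noteq> 0" "\<theta> (4*h) \<noteq> 0"
    and "\<theta> u \<noteq> 0" "\<theta> v \<noteq> 0" "\<theta> (u - v) \<noteq> 0" "\<theta> (u + h) \<noteq> 0" "\<theta> (v + h) \<noteq> 0"
  shows "ratio (2*h) (u - v) * weight h u + ratio (2*h) (v - u) * weight h v
       = \<theta> (5*h) / \<theta> h * (ratio (- (2*h)) u * ratio (- (2*h)) v)
       - \<theta> (6*h) / \<theta> (2*h) * (ratio (- (2*h)) (u + h) * ratio (- (2*h)) (v + h))"
proof -
  define a c where "a = \<theta> (5*h) * \<theta> (2*h) / (\<theta> (4*h) * \<theta> h)" and "c = \<theta> (6*h) / \<theta> (4*h)"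
  have weight: "weight h s = a * ratio (- (4*h)) s - c * ratio (- (4*h)) (s + h)"
    if "\<theta> s \<noteq> 0" "\<theta> (s + h) \<noteq> 0" for s
    unfolding a_def c_def by (rule weight_partial_fractions) (use that h in auto)
  have "ratio (2*h) (u - v) * weight h u + ratio (2*h) (v - u) * weight h v
     = a * (ratio (2*h) (u - v) * ratio (- (4*h)) u + ratio (2*h) (v - u) * ratio (- (4*h)) v)
     - c * (ratio (2*h) ((u + h) - (v + h)) * ratio (- (4*h)) (u + h)
          + ratio (2*h) ((v + h) - (u + h)) * ratio (- (4*h)) (v + h))"
    using assms by (simp add: weight algebra_simps)
  also have "\<dots> = a * (\<theta> (4*h) / \<theta> (2*h) * (ratio (- (2*h)) u * ratio (- (2*h)) v))
     - c * (\<theta> (4*h) / \<theta> (2*h) * (ratio (- (2*h)) (u + h) * ratio (- (2*h)) (v + h)))"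
    using ratio_antisymmetric_sum[of "2*h" u v] ratio_antisymmetric_sum[of "2*h" "u + h" "v + h"] assms
    by simp
  also have "a * (\<theta> (4*h) / \<theta> (2*h) * (ratio (- (2*h)) u * ratio (- (2*h)) v))
    = \<theta> (5*h) / \<theta> h * (ratio (- (2*h)) u * ratio (- (2*h)) v)"
    using h by (simp add: a_def)
  also have "c * (\<theta> (4*h) / \<theta> (2*h) * (ratio (- (2*h)) (u + h) * ratio (- (2*h)) (v + h)))
    = \<theta> (6*h) / \<theta> (2*h) * (ratio (- (2*h)) (u + h) * ratio (- (2*h)) (v + h))"
    using h by (simp add: c_def)
  finally show ?thesis .
qed

section \<open>The conserved combination\<close>

definition admissible :: "complex \<Rightarrow> complex \<Rightarrow> bool" where
  "admissible h u \<longleftrightarrow> \<theta> u \<noteq> 0 \<and> \<theta> (u + h) \<noteq> 0 \<and> \<theta> (u - h) \<noteq> 0"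

text \<open>
  In the sum over \<open>\<plusminus>u\<close> the poles at \<open>0\<close> cancel; only those at \<open>\<plusminus>h\<close> remain.
\<close>

definition subtracted_pair :: "complex \<Rightarrow> complex \<Rightarrow> complex" where
  "subtracted_pair h u = subtracted h u + subtracted h (- u)"

text \<open>
  Reflecting the argument amounts to reversing the step, so statements about \<open>-u\<close> follow from those
  about \<open>u\<close> with \<open>h\<close> replaced by \<open>-h\<close>.
\<close>

lemma subtracted_minus: "subtracted h (- u) = subtracted (- h) u"
proof -
  have "\<theta> (- u - h) = - \<theta> (u + h)" "\<theta> (- u + 2*h) = - \<theta> (u - 2*h)" "\<theta> (- u + h) = - \<theta> (u - h)"
    using theta_minus[of "u + h"] theta_minus[of "u - 2*h"] theta_minus[of "u - h"] by simp_all
  then show ?thesis by (simp add: subtracted_def theta_minus)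
qed

lemma subtracted_difference:
  assumes "\<theta> u \<noteq> 0" "\<theta> w \<noteq> 0" "\<theta> (u + h) \<noteq> 0" "\<theta> (w + h) \<noteq> 0"
  shows "subtracted h u - subtracted h w = \<theta> h * \<theta> (2*h) * \<theta> (u - w) * \<theta> (u + w + h) / (\<theta> u * \<theta> (u + h) * \<theta> w * \<theta> (w + h))"
  using moebius_difference[of "- h" "2*h" 0 h u w] assms
  by (simp add: subtracted_def divide_simps) (simp add: algebra_simps)

text \<open>
  The two Moebius differences for \<open>h\<close> and \<open>-h\<close> combine by \<open>three_point\<close>, which produces a factor
  \<open>\<theta>(u) \<theta>(w)\<close> and thus removes the denominator at \<open>0\<close>.
\<close>

lemma subtracted_pair_difference:
  assumes "admissible h u" "admissible h w"
  shows "subtracted_pair h u - subtracted_pair h w = \<theta> (2*h) ^ 2 * \<theta> (u - w) * \<theta> (u + w)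
           / (\<theta> (u + h) * \<theta> (u - h) * \<theta> (w + h) * \<theta> (w - h))"
proof -
  have nz: "\<theta> u \<noteq> 0" "\<theta> (u + h) \<noteq> 0" "\<theta> (u - h) \<noteq> 0" "\<theta> w \<noteq> 0" "\<theta> (w + h) \<noteq> 0" "\<theta> (w - h) \<noteq> 0"
    using assms by (auto simp: admissible_def)
  have "subtracted_pair h u - subtracted_pair h w = (subtracted h u - subtracted h w) + (subtracted (- h) u - subtracted (- h) w)"
    by (simp add: subtracted_pair_def subtracted_minus)
  also have "subtracted (- h) u - subtracted (- h) w
      = \<theta> h * \<theta> (2*h) * \<theta> (u - w) * \<theta> (u + w - h) / (\<theta> u * \<theta> (u - h) * \<theta> w * \<theta> (w - h))"
    using subtracted_difference[of u w "- h"] nz by (simp add: theta_minus)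
  also have "subtracted h u - subtracted h w + \<dots> = \<theta> (2*h) * \<theta> (u - w)
      * (\<theta> h * (\<theta> (u + w + h) * \<theta> (u - h) * \<theta> (w - h) + \<theta> (u + w - h) * \<theta> (u + h) * \<theta> (w + h)))
      / (\<theta> u * \<theta> w * (\<theta> (u + h) * \<theta> (u - h) * \<theta> (w + h) * \<theta> (w - h)))"
    unfolding subtracted_difference[OF nz(1,4,2,5)] using nz by (simp add: divide_simps) algebra
  also have "\<dots> = \<theta> (2*h) ^ 2 * \<theta> (u - w) * \<theta> (u + w)
           / (\<theta> (u + h) * \<theta> (u - h) * \<theta> (w + h) * \<theta> (w - h))"
    unfolding three_point using nz by (simp add: power2_eq_square mult_ac)
  finally show ?thesis .
qed

definition cross_term :: "complex \<Rightarrow> complex \<Rightarrow> complex \<Rightarrow> complex" where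
  "cross_term h u v = ratio (2*h) (u + v) * ratio (- (2*h)) (u + h) * ratio (- (2*h)) (v + h)
           + ratio (- (2*h)) (u + v) * ratio (2*h) (u - h) * ratio (2*h) (v - h)"

text \<open>
  The difference for one of the two terms of \<open>cross_term\<close>; the other term is this one with \<open>-h\<close>
  for \<open>h\<close>.
\<close>

lemma cross_term_half_difference:
  assumes "\<theta> (u + v) \<noteq> 0" "\<theta> (w + v) \<noteq> 0" "\<theta> (u + h) \<noteq> 0" "\<theta> (w + h) \<noteq> 0" "\<theta> (v + h) \<noteq> 0"
  shows "ratio (2*h) (u + v) * ratio (- (2*h)) (u + h) * ratio (- (2*h)) (v + h)
       - ratio (2*h) (w + v) * ratio (- (2*h)) (w + h) * ratio (- (2*h)) (v + h)
       = \<theta> (2*h) * \<theta> (u - w) * \<theta> (v - h) * \<theta> (u + v + w + h)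
           / (\<theta> (u + v) * \<theta> (w + v) * \<theta> (u + h) * \<theta> (w + h))"
proof -
  have "\<theta> (u + v + 2*h) * \<theta> (u - h) * \<theta> (w + v) * \<theta> (w + h)
      - \<theta> (w + v + 2*h) * \<theta> (w - h) * \<theta> (u + v) * \<theta> (u + h)
      = \<theta> (2*h) * \<theta> (v + h) * \<theta> (u - w) * \<theta> (u + v + w + h)"
    using moebius_difference[of "v + 2*h" "- h" v h u w] theta_minus[of "v + h"]
    by (simp add: theta_minus algebra_simps)
  then have "ratio (2*h) (u + v) * ratio (- (2*h)) (u + h) - ratio (2*h) (w + v) * ratio (- (2*h)) (w + h)
       = \<theta> (2*h) * \<theta> (v + h) * \<theta> (u - w) * \<theta> (u + v + w + h)
           / (\<theta> (u + v) * \<theta> (w + v) * \<theta> (u + h) * \<theta> (w + h))"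
    using assms by (simp add: ratio_def divide_simps) (simp add: algebra_simps)
  then have "(ratio (2*h) (u + v) * ratio (- (2*h)) (u + h) - ratio (2*h) (w + v) * ratio (- (2*h)) (w + h))
         * ratio (- (2*h)) (v + h)
       = \<theta> (2*h) * \<theta> (u - w) * \<theta> (v - h) * \<theta> (u + v + w + h)
           / (\<theta> (u + v) * \<theta> (w + v) * \<theta> (u + h) * \<theta> (w + h))"
    using assms by (simp add: ratio_def mult_ac)
  then show ?thesis by (simp add: algebra_simps)
qed

text \<open>
  By \<open>four_point\<close> the factors \<open>\<theta>(u + v) \<theta>(w + v)\<close> cancel, so the difference does not depend on \<open>v\<close>. It
  is the negative of the difference of \<open>subtracted_pair\<close>.
\<close>

lemma cross_term_difference:
  assumes "admissible h u" "admissible h v" "admissible h w" "\<theta> (u + v) \<noteq> 0" "\<theta> (w + v) \<noteq> 0"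
  shows "cross_term h u v - cross_term h w v = - (\<theta> (2*h) ^ 2 * \<theta> (u - w) * \<theta> (u + w)
           / (\<theta> (u + h) * \<theta> (u - h) * \<theta> (w + h) * \<theta> (w - h)))"
proof -
  have nz: "\<theta> (u + h) \<noteq> 0" "\<theta> (u - h) \<noteq> 0" "\<theta> (w + h) \<noteq> 0" "\<theta> (w - h) \<noteq> 0"
    "\<theta> (v + h) \<noteq> 0" "\<theta> (v - h) \<noteq> 0"
    using assms by (auto simp: admissible_def)
  have "cross_term h u v - cross_term h w v
     = \<theta> (2*h) * \<theta> (u - w) * \<theta> (v - h) * \<theta> (u + v + w + h)
           / (\<theta> (u + v) * \<theta> (w + v) * \<theta> (u + h) * \<theta> (w + h))
     - \<theta> (2*h) * \<theta> (u - w) * \<theta> (v + h) * \<theta> (u + v + w - h)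
           / (\<theta> (u + v) * \<theta> (w + v) * \<theta> (u - h) * \<theta> (w - h))"
    using cross_term_half_difference[of u v w h] cross_term_half_difference[of u v w "- h"] nz assms
    by (simp add: cross_term_def theta_minus algebra_simps)
  also have "\<dots> = \<theta> (2*h) * \<theta> (u - w)
      * (\<theta> (v - h) * \<theta> (u - h) * \<theta> (w - h) * \<theta> (u + v + w + h)
         - \<theta> (v + h) * \<theta> (u + h) * \<theta> (w + h) * \<theta> (u + v + w - h))
      / (\<theta> (u + v) * \<theta> (w + v) * (\<theta> (u + h) * \<theta> (u - h) * \<theta> (w + h) * \<theta> (w - h)))"
    using nz assms(4,5) by (simp add: divide_simps) (simp add: algebra_simps)
  also have "\<dots> = - (\<theta> (2*h) ^ 2 * \<theta> (u - w) * \<theta> (u + w)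
           / (\<theta> (u + h) * \<theta> (u - h) * \<theta> (w + h) * \<theta> (w - h)))"
    unfolding four_point using assms(4,5) by (simp add: power2_eq_square add.commute[of v w] mult_ac)
  finally show ?thesis .
qed

definition invariant :: "complex \<Rightarrow> complex \<Rightarrow> complex \<Rightarrow> complex" where
  "invariant h u v = cross_term h u v + subtracted_pair h u + subtracted_pair h v"

lemma invariant_commute: "invariant h u v = invariant h v u"
  by (simp add: invariant_def cross_term_def algebra_simps)

lemma invariant_move:
  assumes "admissible h u" "admissible h v" "admissible h w" "\<theta> (u + v) \<noteq> 0" "\<theta> (w + v) \<noteq> 0"
  shows "invariant h u v = invariant h w v"
  using cross_term_difference[OF assms] subtracted_pair_difference[OF assms(1,3)] by (simp add: invariant_def algebra_simps)

text \<open>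
  Move \<open>(u, v)\<close> to \<open>(4h, 2h)\<close> one coordinate at a time, through \<open>(2h, v)\<close> or
  \<open>(4h, v)\<close>. One of these points avoids the pole along \<open>u + v = 0\<close>: if both
  \<open>\<theta>(2h + v)\<close> and \<open>\<theta>(4h + v)\<close> vanished, the three-term relation at \<open>4h, 2h, v, h\<close> would force a zero
  of \<open>\<theta>(6h) \<theta>(2h) \<theta>(v + h) \<theta>(v - h)\<close>.
\<close>

lemma invariant_constant:
  assumes h: "\<theta> h \<noteq> 0" "\<theta> (2*h) \<noteq> 0" "\<theta> (3*h) \<noteq> 0" "\<theta> (4*h) \<noteq> 0" "\<theta> (5*h) \<noteq> 0" "\<theta> (6*h) \<noteq> 0"
    and uv: "admissible h u" "admissible h v" "\<theta> (u + v) \<noteq> 0"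
  shows "invariant h u v = invariant h (4*h) (2*h)"
proof -
  have adm: "admissible h (2*h)" "admissible h (4*h)"
    using h by (auto simp: admissible_def algebra_simps)
  have "\<theta> (2*h + v) \<noteq> 0 \<or> \<theta> (4*h + v) \<noteq> 0"
  proof (rule ccontr)
    assume "\<not> ?thesis"
    then have "\<theta> (6*h) * \<theta> (2*h) * (\<theta> (v + h) * \<theta> (v - h)) = 0"
      using three_term[of "4*h" "2*h" v h] by (simp add: algebra_simps)
    then show False using h uv by (simp add: admissible_def)
  qed
  then show ?thesis
  proof
    assume v: "\<theta> (2*h + v) \<noteq> 0"
    have "invariant h u v = invariant h (2*h) v" by (rule invariant_move) (use uv adm v in auto)
    also have "\<dots> = invariant h v (2*h)" by (rule invariant_commute)
    also have "\<dots> = invariant h (4*h) (2*h)" by (rule invariant_move) (use uv adm v h in \<open>auto simp: add.commute\<close>)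
    finally show ?thesis .
  next
    assume v: "\<theta> (4*h + v) \<noteq> 0"
    have "invariant h u v = invariant h (4*h) v" by (rule invariant_move) (use uv adm v in auto)
    also have "\<dots> = invariant h v (4*h)" by (rule invariant_commute)
    also have "\<dots> = invariant h (2*h) (4*h)" by (rule invariant_move) (use uv adm v h in \<open>auto simp: add.commute\<close>)
    also have "\<dots> = invariant h (4*h) (2*h)" by (rule invariant_commute)
    finally show ?thesis .
  qed
qed

text \<open>
  The point \<open>(4h, 2h)\<close> is chosen so that all arguments are multiples of \<open>h\<close> and one of the
  terms vanishes, since \<open>subtracted\<close> has a zero at \<open>-2h\<close>.
\<close>

lemma invariant_value:
  assumes h: "\<theta> h \<noteq> 0" "\<theta> (2*h) \<noteq> 0" "\<theta> (3*h) \<noteq> 0"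
  shows "invariant h (4*h) (2*h) = \<theta> (8*h) * \<theta> h / (\<theta> (6*h) * \<theta> (5*h)) + \<theta> (4*h) * \<theta> (5*h) / (\<theta> (6*h) * \<theta> h)
     + (\<theta> (5*h) * \<theta> (2*h) / (\<theta> (4*h) * \<theta> (3*h)) + \<theta> (6*h) * \<theta> (3*h) / (\<theta> (5*h) * \<theta> (4*h)))
     + \<theta> (4*h) * \<theta> h / (\<theta> (3*h) * \<theta> (2*h))"
proof -
  have "cross_term h (4*h) (2*h) = \<theta> (8*h) * \<theta> h / (\<theta> (6*h) * \<theta> (5*h)) + \<theta> (4*h) * \<theta> (5*h) / (\<theta> (6*h) * \<theta> h)"
    using h by (simp add: cross_term_def ratio_def)
  moreover have "subtracted_pair h (4*h) = \<theta> (5*h) * \<theta> (2*h) / (\<theta> (4*h) * \<theta> (3*h)) + \<theta> (6*h) * \<theta> (3*h) / (\<theta> (5*h) * \<theta> (4*h))"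
    by (simp add: subtracted_pair_def subtracted_def theta_minus mult_ac)
  moreover have "subtracted_pair h (2*h) = \<theta> (4*h) * \<theta> h / (\<theta> (3*h) * \<theta> (2*h))"
    by (simp add: subtracted_pair_def subtracted_def theta_0 mult_ac)
  ultimately show ?thesis by (simp add: invariant_def)
qed

section \<open>The identity\<close>

text \<open>
  The weighted sum at \<open>(-u, -v)\<close> has the same shape as at \<open>(u, v)\<close>, so both brackets factorise by
  \<open>weight_antisymmetric_sum\<close>. The prefactor \<open>\<theta>(2h)/\<theta>(6h)\<close> normalises the coefficient of \<open>cross_term\<close>
  to \<open>-1\<close>, which is what makes it combine with the subtracted terms to the conserved combination.
\<close>

lemma weighted_sum_eq_constant:
  assumes "\<theta> (2*h) \<noteq> 0" "\<theta> (3*h) \<noteq> 0" "\<theta> (4*h) \<noteq> 0" "\<theta> (5*h) \<noteq> 0" "\<theta> (6*h) \<noteq> 0"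
    and uv: "admissible h u" "admissible h v" "\<theta> (u + v) \<noteq> 0" "\<theta> (u - v) \<noteq> 0"
  shows "\<theta> (2*h) / \<theta> (6*h)
       * (ratio (2*h) (u + v) * (ratio (2*h) (u - v) * weight h u + ratio (2*h) (v - u) * weight h v)
        + ratio (2*h) (- (u + v)) * (ratio (2*h) (u - v) * weight h (- v) + ratio (2*h) (v - u) * weight h (- u)))
       - (subtracted h u + subtracted h (- u) + subtracted h v + subtracted h (- v))
     = - (\<theta> (8*h) * \<theta> h / (\<theta> (6*h) * \<theta> (5*h))
        + \<theta> (5*h) * \<theta> (2*h) / (\<theta> (4*h) * \<theta> (3*h))
        + \<theta> (6*h) * \<theta> (3*h) / (\<theta> (5*h) * \<theta> (4*h))
        + \<theta> (4*h) * \<theta> h / (\<theta> (3*h) * \<theta> (2*h)))"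
proof -
  have th: "\<theta> h \<noteq> 0" by (rule theta_step_nonzero) (use assms in auto)
  note h = th assms(1-5)
  have nz: "\<theta> u \<noteq> 0" "\<theta> (u + h) \<noteq> 0" "\<theta> (u - h) \<noteq> 0" "\<theta> v \<noteq> 0" "\<theta> (v + h) \<noteq> 0" "\<theta> (v - h) \<noteq> 0"
    using uv by (auto simp: admissible_def)
  have nz': "\<theta> (- u) \<noteq> 0" "\<theta> (- u + h) \<noteq> 0" "\<theta> (- v) \<noteq> 0" "\<theta> (- v + h) \<noteq> 0" "\<theta> (- v - - u) \<noteq> 0"
    using nz uv theta_minus[of "u - h"] theta_minus[of "v - h"] by (auto simp: theta_minus)
  define a c where "a = \<theta> (5*h) / \<theta> h" and "c = \<theta> (6*h) / \<theta> (2*h)"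
  have Q: "ratio (2*h) (u - v) * weight h u + ratio (2*h) (v - u) * weight h v
       = a * (ratio (- (2*h)) u * ratio (- (2*h)) v)
       - c * (ratio (- (2*h)) (u + h) * ratio (- (2*h)) (v + h))"
    unfolding a_def c_def by (rule weight_antisymmetric_sum) (use h nz uv in auto)
  have "ratio (2*h) (- v - - u) * weight h (- v) + ratio (2*h) (- u - - v) * weight h (- u)
       = a * (ratio (- (2*h)) (- v) * ratio (- (2*h)) (- u))
       - c * (ratio (- (2*h)) (- v + h) * ratio (- (2*h)) (- u + h))"
    unfolding a_def c_def by (rule weight_antisymmetric_sum) (use h nz' in auto)
  moreover have "ratio (- (2*h)) (- s + h) = ratio (2*h) (s - h)" for s
    using ratio_minus[of "- (2*h)" "s - h"] by simp
  ultimately have Q': "ratio (2*h) (u - v) * weight h (- v) + ratio (2*h) (v - u) * weight h (- u)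
       = a * (ratio (2*h) u * ratio (2*h) v) - c * (ratio (2*h) (u - h) * ratio (2*h) (v - h))"
    by (simp add: ratio_minus mult_ac)
  have "ratio (2*h) (u + v) * (ratio (2*h) (u - v) * weight h u + ratio (2*h) (v - u) * weight h v)
      + ratio (2*h) (- (u + v)) * (ratio (2*h) (u - v) * weight h (- v) + ratio (2*h) (v - u) * weight h (- u))
      = a * (ratio (2*h) (u + v) * ratio (- (2*h)) u * ratio (- (2*h)) v
           + ratio (- (2*h)) (u + v) * ratio (2*h) u * ratio (2*h) v)
      - c * cross_term h u v"
    unfolding Q Q' ratio_minus cross_term_def by (simp add: algebra_simps)
  also have "\<dots> = a * (\<theta> (4*h) / \<theta> (2*h)) - c * cross_term h u v"
    using ratio_symmetrization[of "2*h" u v] h nz uv by simp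
  finally have "\<theta> (2*h) / \<theta> (6*h)
       * (ratio (2*h) (u + v) * (ratio (2*h) (u - v) * weight h u + ratio (2*h) (v - u) * weight h v)
        + ratio (2*h) (- (u + v)) * (ratio (2*h) (u - v) * weight h (- v) + ratio (2*h) (v - u) * weight h (- u)))
      = \<theta> (2*h) / \<theta> (6*h) * (a * (\<theta> (4*h) / \<theta> (2*h)) - c * cross_term h u v)"
    by simp
  also have "\<dots> = \<theta> (4*h) * \<theta> (5*h) / (\<theta> (6*h) * \<theta> h) - cross_term h u v"
    using h by (simp add: a_def c_def field_simps)
  also have "cross_term h u v = invariant h (4*h) (2*h) - subtracted_pair h u - subtracted_pair h v"
    using invariant_constant[OF h uv(1-3)] by (simp add: invariant_def algebra_simps)
  finally show ?thesis
    unfolding invariant_value[OF h(1-3)] by (simp add: subtracted_pair_def algebra_simps)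
qed

end

theorem lemma1:
  fixes \<tau> h :: complex and l :: "complex^2"
  assumes "Im \<tau> > 0"
    and "\<And>k::nat. 2 \<le> k \<Longrightarrow> k \<le> 6 \<Longrightarrow> theta1 \<tau> (of_nat k * h) \<noteq> 0"
    and "regular_point \<tau> h l"
  shows "(\<Sum>p\<in>{\<epsilon>1, -\<epsilon>1}. \<Sum>q\<in>{\<epsilon>2, -\<epsilon>2}. U \<tau> h (hform l p) (hform l q))
       - (\<Sum>p\<in>{\<epsilon>1, -\<epsilon>1}. \<Sum>q\<in>{\<epsilon>2, -\<epsilon>2}.
            (theta1 \<tau> (hform l (p + q) - h) * theta1 \<tau> (hform l (p + q) + 2*h))
            / (theta1 \<tau> (hform l (p + q)) * theta1 \<tau> (hform l (p + q) + h)))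
       = K \<tau> h"
proof -
  interpret determinantal_theta "theta1 \<tau>" "even_theta \<tau>" "odd_theta \<tau>"
    by unfold_locales (rule theta1_product[OF assms(1)])
  define a b where "a = hform l \<epsilon>1" and "b = hform l \<epsilon>2"
  have neq: "\<epsilon>1 \<noteq> - \<epsilon>1" "\<epsilon>2 \<noteq> - \<epsilon>2"
    by (auto simp: \<epsilon>1_def \<epsilon>2_def vec_eq_iff axis_def)
  have neg: "hform l (- p) = - hform l p" for p
    by (simp add: hform_def sum_negf)
  have add: "hform l (p + q) = hform l p + hform l q" for p q
    by (simp add: hform_def algebra_simps sum.distrib)
  have U: "U \<tau> h x y = theta1 \<tau> (2*h) / theta1 \<tau> (6*h) * (ratio (2*h) (2*x) * ratio (2*h) (2*y) * weight h (x + y))" for x y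
    by (simp add: U_def ratio_def weight_def mult_ac)
  have subtracted: "theta1 \<tau> (s - h) * theta1 \<tau> (s + 2*h) / (theta1 \<tau> s * theta1 \<tau> (s + h)) = subtracted h s" for s
    by (simp add: subtracted_def)
  define u v where "u = a + b" and "v = b - a"
  have ab: "2 * a = u - v" "2 * b = u + v" "a + b = u" "- a + b = v" "a + - b = - v" "- a + - b = - u"
    "2 * - a = v - u" "2 * - b = - (u + v)" "a - b = - v" "b - a = v" "- a - b = - u"
    by (simp_all add: u_def v_def)
  have reg: "theta1 \<tau> (u - v) \<noteq> 0" "theta1 \<tau> (u + v) \<noteq> 0" "theta1 \<tau> u \<noteq> 0" "theta1 \<tau> v \<noteq> 0"
    "theta1 \<tau> (u + h) \<noteq> 0" "theta1 \<tau> (v + h) \<noteq> 0" "theta1 \<tau> (- u + h) \<noteq> 0" "theta1 \<tau> (- v + h) \<noteq> 0"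
    using assms(3) by (auto simp: regular_point_def neg add a_def[symmetric] b_def[symmetric] ab)
  have adm: "admissible h u" "admissible h v"
    using reg theta_minus[of "u - h"] theta_minus[of "v - h"] by (auto simp: admissible_def)
  have h: "theta1 \<tau> (2*h) \<noteq> 0" "theta1 \<tau> (3*h) \<noteq> 0" "theta1 \<tau> (4*h) \<noteq> 0"
    "theta1 \<tau> (5*h) \<noteq> 0" "theta1 \<tau> (6*h) \<noteq> 0"
    using assms(2)[of 2] assms(2)[of 3] assms(2)[of 4] assms(2)[of 5] assms(2)[of 6] by simp_all
  have "(\<Sum>p\<in>{\<epsilon>1, -\<epsilon>1}. \<Sum>q\<in>{\<epsilon>2, -\<epsilon>2}. U \<tau> h (hform l p) (hform l q))
      = U \<tau> h a b + U \<tau> h a (- b) + U \<tau> h (- a) b + U \<tau> h (- a) (- b)"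
    using neq by (simp add: neg a_def b_def)
  also have "\<dots> = theta1 \<tau> (2*h) / theta1 \<tau> (6*h)
       * (ratio (2*h) (u + v) * (ratio (2*h) (u - v) * weight h u + ratio (2*h) (v - u) * weight h v)
        + ratio (2*h) (- (u + v)) * (ratio (2*h) (u - v) * weight h (- v) + ratio (2*h) (v - u) * weight h (- u)))"
    unfolding U ab by (simp only: algebra_simps)
  finally have sum_U: "(\<Sum>p\<in>{\<epsilon>1, -\<epsilon>1}. \<Sum>q\<in>{\<epsilon>2, -\<epsilon>2}. U \<tau> h (hform l p) (hform l q)) = \<dots>" .
  have "(\<Sum>p\<in>{\<epsilon>1, -\<epsilon>1}. \<Sum>q\<in>{\<epsilon>2, -\<epsilon>2}. subtracted h (hform l (p + q)))
      = subtracted h (a + b) + subtracted h (a + - b) + subtracted h (- a + b) + subtracted h (- a + - b)"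
    using neq by (simp add: add neg a_def b_def)
  also have "\<dots> = subtracted h u + subtracted h (- u) + subtracted h v + subtracted h (- v)"
    unfolding ab by simp
  finally have sum_S: "(\<Sum>p\<in>{\<epsilon>1, -\<epsilon>1}. \<Sum>q\<in>{\<epsilon>2, -\<epsilon>2}. subtracted h (hform l (p + q))) = \<dots>" .
  show ?thesis
    unfolding subtracted sum_U sum_S K_def by (rule weighted_sum_eq_constant[OF h adm reg(2,1)])
qed

end
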